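(* Let $N$ be a squarefree positive integer and let $\{f_j\}_{j\ge 1}$ be the Maass newforms of level $N$ with trivial character, with Laplace eigenvalues $0<\lambda_1\le\lambda_2\le\cdots$. Let $\widetilde{\lambda}_i\in\mathbb{R}$ and $\varepsilon_i\ge 0$, for $i$ in a finite set of positive integers, be such that each interval $[\widetilde{\lambda}_i-\varepsilon_i,\widetilde{\lambda}_i+\varepsilon_i]$ contains at least one of the eigenvalues $\lambda_j$. Let $H^*:(0,\infty)\to(0,\infty)$ be a positive, monotonically decreasing function such that $t(1,H^* )=\sum_{j=1}^\infty H^*(\lambda_j)$ converges. Then every eigenvalue $\lambda\in\{\lambda_j:j\ge1\}$ that is not contained in $\bigcup_i[\widetilde{\lambda}_i-\varepsilon_i,\widetilde{\lambda}_i+\varepsilon_i]$ satisfies $$H^*(\lambda)\le t(1,H^* )-\sum_i H^*(\widetilde{\lambda}_i+\varepsilon_i),$$ where the sum ranges over all $i$ such that $[\widetilde{\lambda}_i-\varepsilon_i,\widetilde{\lambda}_i+\varepsilon_i]$ does not overlap (i.e. is disjoint from) the corresponding interval for any smaller value of $i$.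
   Context: A Maass cusp form (weight $0$) for $\Gamma_0(N)$ is a non-constant smooth $\Gamma_0(N)$-invariant function on the upper half-plane that lies in $L^2(\Gamma_0(N)\backslash\mathbb{H})$, vanishes at the cusps, and is an eigenfunction of $\Delta=-y^2(\partial_x^2+\partial_y^2)$. Newforms are those in the orthogonal complement (for the Petersson inner product) of the span of the oldforms $f(kz)$, with $f$ a form for $\Gamma_0(K)$, $K\mid N$, $K<N$, $k\mid N/K$. The sequence $\{f_j\}_{j\ge1}$ is a basis, consisting of normalised Hecke eigenforms, of the direct sum over $\lambda>0$ of the spaces of Maass newforms of level $N$, trivial character and Laplace eigenvalue $\lambda$; $\lambda_j$ is the Laplace eigenvalue of $f_j$ (eigenvalues listed with multiplicity). *)

theory Defs
  imports
    "HOL-Analysis.Analysis"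
    "HOL-Library.Function_Algebras"
    "HOL-Computational_Algebra.Squarefree"
begin

section \<open>The upper half-plane and the groups $\Gamma_0(N)$\<close>

definition upper_half_plane :: "complex set" where
  "upper_half_plane = {z. Im z > 0}"

definition Gamma0 :: "nat \<Rightarrow> (int ^ 2 ^ 2) set" where
  "Gamma0 N = {\<gamma>. det \<gamma> = 1 \<and> int N dvd \<gamma> $ 2 $ 1}"

definition act :: "int ^ 2 ^ 2 \<Rightarrow> complex \<Rightarrow> complex" where
  "act \<gamma> = moebius (of_int (\<gamma> $ 1 $ 1)) (of_int (\<gamma> $ 1 $ 2))
                   (of_int (\<gamma> $ 2 $ 1)) (of_int (\<gamma> $ 2 $ 2))"

text \<open>
  The Ford fundamental domain of \<open>\<Gamma>\<^sub>0(N)\<close>: the points of maximal height in their orbit,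
  cut down to a strip of width one (the width of the cusp at infinity). It meets every orbit,
  and its interior points are pairwise inequivalent; its boundary has measure zero.
  Integrals over \<open>\<Gamma>\<^sub>0(N)\H\<close> are integrals over this set with respect to \<open>dx dy / y^2\<close>.
\<close>

definition ford_domain :: "nat \<Rightarrow> complex set" where
  "ford_domain N = {z \<in> upper_half_plane.
     \<bar>Re z\<bar> \<le> 1 / 2 \<and> (\<forall>\<gamma>\<in>Gamma0 N. Im (act \<gamma> z) \<le> Im z)}"

definition petersson :: "nat \<Rightarrow> (complex \<Rightarrow> complex) \<Rightarrow> (complex \<Rightarrow> complex) \<Rightarrow> complex" where
  "petersson N f g = (LINT z:ford_domain N|lborel. f z * cnj (g z) / of_real ((Im z)\<^sup>2))"


section \<open>Smooth functions and the Laplacian\<close>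

definition partial_x :: "(complex \<Rightarrow> complex) \<Rightarrow> complex \<Rightarrow> complex" where
  "partial_x f z = frechet_derivative f (at z) 1"

definition partial_y :: "(complex \<Rightarrow> complex) \<Rightarrow> complex \<Rightarrow> complex" where
  "partial_y f z = frechet_derivative f (at z) \<i>"

primrec C_k_on :: "nat \<Rightarrow> (complex \<Rightarrow> complex) \<Rightarrow> complex set \<Rightarrow> bool" where
  "C_k_on 0 f S \<longleftrightarrow> continuous_on S f"
| "C_k_on (Suc k) f S \<longleftrightarrow>
     (\<forall>z\<in>S. f differentiable (at z)) \<and> C_k_on k (partial_x f) S \<and> C_k_on k (partial_y f) S"

text \<open>Smoothness is that of functions of two real variables, and is meant for open \<open>S\<close>.\<close>

definition smooth_on :: "(complex \<Rightarrow> complex) \<Rightarrow> complex set \<Rightarrow> bool" where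
  "smooth_on f S \<longleftrightarrow> (\<forall>k. C_k_on k f S)"

definition laplacian :: "(complex \<Rightarrow> complex) \<Rightarrow> complex \<Rightarrow> complex" where
  "laplacian f z =
     - of_real ((Im z)\<^sup>2) * (partial_x (partial_x f) z + partial_y (partial_y f) z)"


section \<open>Maass cusp forms\<close>

text \<open>
  A function on the upper half-plane is represented by its extension by zero to \<open>complex\<close>
  (first conjunct below), so that equality and linear relations between such functions
  are equality and linear relations in \<open>complex \<Rightarrow> complex\<close>.

  Cusps are the points \<open>\<sigma>(\<infinity>)\<close> with \<open>\<sigma> \<in> SL\<^sub>2(Z)\<close> (which is \<open>Gamma0 1\<close>), and vanishing there is
  \<open>f(\<sigma> z) \<rightarrow> 0\<close> as \<open>Im z \<rightarrow> \<infinity>\<close>, uniformly in \<open>Re z\<close>.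
\<close>

definition maass_cusp_form :: "nat \<Rightarrow> complex \<Rightarrow> (complex \<Rightarrow> complex) \<Rightarrow> bool" where
  "maass_cusp_form N \<mu> f \<longleftrightarrow>
     (\<forall>z. z \<notin> upper_half_plane \<longrightarrow> f z = 0) \<and>
     \<not> f constant_on upper_half_plane \<and>
     smooth_on f upper_half_plane \<and>
     (\<forall>\<gamma>\<in>Gamma0 N. \<forall>z\<in>upper_half_plane. f (act \<gamma> z) = f z) \<and>
     set_integrable lborel (ford_domain N) (\<lambda>z. (cmod (f z))\<^sup>2 / (Im z)\<^sup>2) \<and>
     (\<forall>\<sigma>\<in>Gamma0 1. ((\<lambda>z. f (act \<sigma> z)) \<longlongrightarrow> 0) (filtercomap Im at_top)) \<and>
     (\<forall>z\<in>upper_half_plane. laplacian f z = \<mu> * f z)"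


section \<open>Newforms\<close>

global_interpretation cfun: vector_space "\<lambda>(c::complex) (f::complex \<Rightarrow> complex) z. c * f z"
  defines cfun_span = cfun.span
    and cfun_dependent = cfun.dependent
  by unfold_locales (auto simp: fun_eq_iff algebra_simps)

definition oldforms :: "nat \<Rightarrow> (complex \<Rightarrow> complex) set" where
  "oldforms N = {(\<lambda>z. f (of_nat k * z)) | f k K \<mu>.
     maass_cusp_form K \<mu> f \<and> K dvd N \<and> K < N \<and> k dvd N div K}"

definition maass_newform :: "nat \<Rightarrow> complex \<Rightarrow> (complex \<Rightarrow> complex) \<Rightarrow> bool" where
  "maass_newform N \<mu> f \<longleftrightarrow>
     maass_cusp_form N \<mu> f \<and> (\<forall>g\<in>cfun.span (oldforms N). petersson N f g = 0)"


section \<open>Normalised Hecke eigenforms\<close>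

text \<open>
  The weight 0 Hecke operator with trivial character,
  \<open>T\<^sub>n f(z) = n^(-1/2) \<Sum>\<^bsub>ad = n, (a, N) = 1\<^esub> \<Sum>\<^bsub>0 \<le> b < d\<^esub> f((a z + b) / d)\<close>.
  For primes dividing \<open>N\<close> this is the operator usually called \<open>U\<^sub>p\<close>.
\<close>

definition hecke :: "nat \<Rightarrow> nat \<Rightarrow> (complex \<Rightarrow> complex) \<Rightarrow> complex \<Rightarrow> complex" where
  "hecke N n f z = (1 / of_real (sqrt (real n))) *
     (\<Sum>a | a dvd n \<and> coprime a N. \<Sum>b<n div a.
        f ((of_nat a * z + of_nat b) / of_nat (n div a)))"

definition hecke_eigenform :: "nat \<Rightarrow> (complex \<Rightarrow> complex) \<Rightarrow> bool" where
  "hecke_eigenform N f \<longleftrightarrow> (\<forall>n\<ge>1. \<exists>\<mu>. \<forall>z\<in>upper_half_plane. hecke N n f z = \<mu> * f z)"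

definition bessel_K :: "complex \<Rightarrow> real \<Rightarrow> complex" where
  "bessel_K \<nu> u = (LINT t:{0..}|lborel. of_real (exp (- u * cosh t)) * cosh (\<nu> * of_real t))"

text \<open>
  With eigenvalue \<open>\<mu> = 1/4 + r^2\<close>, a Maass cusp form has the expansion
  \<open>f(x + iy) = \<surd>y \<Sum>\<^bsub>n \<noteq> 0\<^esub> a(n) K\<^bsub>ir\<^esub>(2\<pi>|n|y) e(nx)\<close>; normalised means \<open>a(1) = 1\<close>.
  The choice of the square root \<open>ir\<close> of \<open>1/4 - \<mu>\<close> is irrelevant as \<open>K\<close> is even in its index.
\<close>

definition normalised :: "complex \<Rightarrow> (complex \<Rightarrow> complex) \<Rightarrow> bool" where
  "normalised \<mu> f \<longleftrightarrow> (\<forall>y>0.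
     (LINT x:{0..1}|lborel. f (Complex x y) * cis (- 2 * pi * x)) =
       of_real (sqrt y) * bessel_K (csqrt (1 / 4 - \<mu>)) (2 * pi * y))"


section \<open>The sequence of newforms of level $N$\<close>

text \<open>
  Indices start at 1; the values at index 0 are irrelevant. The span of the union over
  \<open>\<mu> > 0\<close> of the newforms of eigenvalue \<open>\<mu>\<close> is the direct sum of the spaces of newforms,
  eigenspaces for distinct eigenvalues being independent.
\<close>

definition maass_newform_basis ::
    "nat \<Rightarrow> (nat \<Rightarrow> complex \<Rightarrow> complex) \<Rightarrow> (nat \<Rightarrow> real) \<Rightarrow> bool" where
  "maass_newform_basis N f lam \<longleftrightarrow>
     (\<forall>j\<ge>1. lam j > 0 \<and> maass_newform N (of_real (lam j)) (f j) \<and>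
            hecke_eigenform N (f j) \<and> normalised (of_real (lam j)) (f j)) \<and>
     mono_on {1..} lam \<and>
     inj_on f {1..} \<and>
     \<not> cfun.dependent (f ` {1..}) \<and>
     cfun.span (f ` {1..}) = cfun.span {g. \<exists>\<mu>>0. maass_newform N (of_real \<mu>) g}"

end

theory Submission
  imports Defs
begin

text \<open>
  The bound is a counting argument about the series \<open>t(1,H\<^sup>*)\<close>. Two of the intervals that
  contribute to the sum are disjoint, since the one with the larger index was selected for being
  disjoint from all earlier intervals. Choosing an eigenvalue in each of them therefore selects
  distinct terms of that series, and the eigenvalue \<open>\<lambda>\<close> outside all intervals selects a further
  one. As all terms are positive, the sum of the selected ones is at most \<open>t(1,H\<^sup>*)\<close>; as \<open>H\<^sup>*\<close>
  decreases, its value at an eigenvalue is at least its value at the right endpoint of the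
  interval containing it.
\<close>

text \<open>
  The chosen terms are counted by index, not by value, so multiplicities in the sequence are
  harmless: disjointness of the intervals already separates the indices.
\<close>

lemma antimono_at_uncovered_plus_sum_endpoints_le_suminf:
  fixes x :: "nat \<Rightarrow> real" and a b :: "'i \<Rightarrow> real" and H :: "real \<Rightarrow> real"
  assumes pos: "\<And>n. x n > 0"
    and H_nonneg: "\<And>t. t > 0 \<Longrightarrow> H t \<ge> 0"
    and H_anti: "antimono_on {0<..} H"
    and summable: "summable (\<lambda>n. H (x n))"
    and fin: "finite S"
    and hit: "\<And>i. i \<in> S \<Longrightarrow> \<exists>n. x n \<in> {a i..b i}"
    and disj: "disjoint_family_on (\<lambda>i. {a i..b i}) S"
    and uncovered: "x m \<notin> (\<Union>i\<in>S. {a i..b i})"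
  shows "H (x m) + (\<Sum>i\<in>S. H (b i)) \<le> (\<Sum>n. H (x n))"
proof -
  obtain n where n: "\<And>i. i \<in> S \<Longrightarrow> x (n i) \<in> {a i..b i}"
    using bchoice[of S "\<lambda>i n. x n \<in> {a i..b i}"] hit by blast
  have inj: "inj_on n S"
  proof (rule inj_onI)
    fix i k assume "i \<in> S" "k \<in> S" "n i = n k"
    then have "x (n i) \<in> {a i..b i} \<inter> {a k..b k}"
      using n[of i] n[of k] by simp
    with disj \<open>i \<in> S\<close> \<open>k \<in> S\<close> show "i = k"
      unfolding disjoint_family_on_def by blast
  qed
  have m: "m \<notin> n ` S"
    using n uncovered by blast
  have "(\<Sum>i\<in>S. H (b i)) \<le> (\<Sum>i\<in>S. H (x (n i)))"
  proof (rule sum_mono)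
    fix i assume "i \<in> S"
    then have "x (n i) \<le> b i"
      using n by simp
    moreover have "0 < x (n i)"
      by (rule pos)
    ultimately show "H (b i) \<le> H (x (n i))"
      using monotone_onD[OF H_anti, of "x (n i)" "b i"] by simp
  qed
  also have "\<dots> = (\<Sum>j\<in>n ` S. H (x j))"
    by (simp add: sum.reindex[OF inj])
  finally have "H (x m) + (\<Sum>i\<in>S. H (b i)) \<le> (\<Sum>j\<in>insert m (n ` S). H (x j))"
    using fin m by simp
  also have "\<dots> \<le> (\<Sum>j. H (x j))"
    by (rule sum_le_suminf) (simp_all add: summable fin pos H_nonneg)
  finally show ?thesis .
qed

theorem mainTheorem2:
  fixes N :: nat
    and f :: "nat \<Rightarrow> complex \<Rightarrow> complex" and lam :: "nat \<Rightarrow> real"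
    and I :: "nat set" and lamt eps :: "nat \<Rightarrow> real"
    and H :: "real \<Rightarrow> real"
  assumes "N > 0" and "squarefree N"
    and "maass_newform_basis N f lam"
    and "finite I" and "\<forall>i\<in>I. i \<ge> 1"
    and "\<forall>i\<in>I. eps i \<ge> 0"
    and "\<forall>i\<in>I. \<exists>j\<ge>1. lam j \<in> {lamt i - eps i .. lamt i + eps i}"
    and "\<forall>x>0. H x > 0"
    and "antimono_on {0<..} H"
    and "summable (\<lambda>j. H (lam (Suc j)))"
  shows "\<forall>\<mu>\<in>lam ` {1..}.
    \<mu> \<notin> (\<Union>i\<in>I. {lamt i - eps i .. lamt i + eps i}) \<longrightarrow>
    H \<mu> \<le> (\<Sum>j. H (lam (Suc j))) -
      (\<Sum>i | i \<in> I \<and> (\<forall>k\<in>I. k < i \<longrightarrow>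
          {lamt i - eps i .. lamt i + eps i} \<inter> {lamt k - eps k .. lamt k + eps k} = {}).
        H (lamt i + eps i))"
proof (intro ballI impI)
  fix \<mu>
  assume "\<mu> \<in> lam ` {1..}"
    and uncovered: "\<mu> \<notin> (\<Union>i\<in>I. {lamt i - eps i .. lamt i + eps i})"
  then obtain j where j: "j \<ge> 1" "\<mu> = lam j"
    by auto
  have m: "\<mu> = lam (Suc (j - 1))"
    using j by simp
  define J where "J i = {lamt i - eps i .. lamt i + eps i}" for i
  define S where "S = {i \<in> I. \<forall>k\<in>I. k < i \<longrightarrow> J i \<inter> J k = {}}"
  have pos: "lam (Suc n) > 0" for n
    using assms(3) by (simp add: maass_newform_basis_def)
  have hit: "\<exists>n. lam (Suc n) \<in> J i" if "i \<in> S" for i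
  proof -
    have "i \<in> I"
      using that by (simp add: S_def)
    from bspec[OF assms(7) this] obtain j where "j \<ge> 1" "lam j \<in> J i"
      unfolding J_def by (elim exE conjE)
    then have "lam (Suc (j - 1)) \<in> J i"
      by simp
    then show ?thesis ..
  qed
  have later_disjoint: "J i \<inter> J k = {}" if "i \<in> S" "k \<in> S" "k < i" for i k
    using that by (simp add: S_def)
  have disj: "disjoint_family_on J S"
    unfolding disjoint_family_on_def
    by (intro ballI impI) (metis later_disjoint Int_commute linorder_neqE_nat)
  have "H (lam (Suc (j - 1))) + (\<Sum>i\<in>S. H (lamt i + eps i)) \<le> (\<Sum>n. H (lam (Suc n)))"
  proof (rule antimono_at_uncovered_plus_sum_endpoints_le_suminf
      [where x = "\<lambda>n. lam (Suc n)" and a = "\<lambda>i. lamt i - eps i" and b = "\<lambda>i. lamt i + eps i",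
        folded J_def, OF pos _ assms(9,10) _ hit disj])
    show "lam (Suc (j - 1)) \<notin> (\<Union>i\<in>S. J i)"
      using uncovered unfolding m[symmetric] by (simp add: S_def J_def)
    show "finite S"
      using assms(4) by (simp add: S_def)
    show "H t \<ge> 0" if "t > 0" for t
      using assms(8) that by (simp add: less_imp_le)
  qed
  then show "H \<mu> \<le> (\<Sum>j. H (lam (Suc j))) -
      (\<Sum>i | i \<in> I \<and> (\<forall>k\<in>I. k < i \<longrightarrow>
          {lamt i - eps i .. lamt i + eps i} \<inter> {lamt k - eps k .. lamt k + eps k} = {}).
        H (lamt i + eps i))"
    unfolding m S_def J_def le_diff_eq .
qed

end
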